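(* Let $S\neq\mathbb{N}$ be a numerical semigroup with maximal ideal $M=S\setminus\{0\}$ and multiplicity $e=\min M$. Then $S$ is GAS if and only if the translate $M-e=\{m-e\mid m\in M\}$ is an almost canonical ideal of the numerical semigroup $M-M=\{x\in\mathbb{Z}\mid x+M\subseteq M\}$.
   Context: A numerical semigroup is a submonoid $S$ of $(\mathbb{N},+)$ (with $0\in\mathbb{N}$) such that $\mathbb{N}\setminus S$ is finite. For a numerical semigroup $S$: $F(S)=\max(\mathbb{Z}\setminus S)$ (so $F(\mathbb{N})=-1$); $M(S)=S\setminus\{0\}$; $K(S)=\{x\in\mathbb{N}\mid F(S)-x\notin S\}$; $S$ has a unique minimal system of generators, whose elements are called the minimal generators of $S$. For sets $X,Y\subseteq\mathbb{Z}$, $X-Y=\{z\in\mathbb{Z}\mid z+Y\subseteq X\}$, while for an integer $e$, $X-e=\{x-e\mid x\in X\}$; $2X=X+X$. Put $PF(S)=(S-M(S))\setminus S$. GAS: $S$, with $K=K(S)$, is GAS (generalized almost symmetric) if either $2K=K$ or $2K\setminus K=\{F(S)-x_1,\dots,F(S)-x_r,F(S)\}$ for some $r\ge 0$ and some minimal generators $x_1,\dots,x_r$ of $S$ such that $x_i-x_j\notin PF(S)$ for every $i,j$. Almost canonical ideals: let $T$ be a numerical semigroup. A relative ideal of $T$ is a nonempty set $I\subseteq\mathbb{Z}$ with $I+T\subseteq I$ and $z+I\subseteq T$ for some $z\in T$. Put $F(I)=\max(\mathbb{Z}\setminus I)$ and $\widetilde I=I+(F(T)-F(I))$. The relative ideal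 $I$ of $T$ is almost canonical if $\widetilde I-M(T)=K(T)\cup\{F(T)\}$. *)

theory Defs
  imports Main "HOL.Hull" "HOL-Library.Set_Algebras"
begin

text \<open>
  All sets live in the integers, so that \<open>F(S)\<close>, \<open>PF(S)\<close>, differences of sets and relative ideals
  share one type; a numerical semigroup is an \<^typ>\<open>int set\<close> contained in \<open>{0..}\<close>.
  Between sets of integers, \<open>X - Y\<close> is set difference; the ideal-theoretic difference
  is \<open>colon X Y\<close>. \<open>A + B\<close> and \<open>a +o B\<close> are the elementwise sum and the translate.
\<close>

definition add_submonoid :: "int set \<Rightarrow> bool" where
  "add_submonoid A \<longleftrightarrow> 0 \<in> A \<and> (\<forall>x\<in>A. \<forall>y\<in>A. x + y \<in> A)"

definition numerical_semigroup :: "int set \<Rightarrow> bool" where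
  "numerical_semigroup S \<longleftrightarrow> S \<subseteq> {0..} \<and> add_submonoid S \<and> finite ({0..} - S)"

text \<open>
  The maximum of \<open>\<int> \<setminus> I\<close>, for a numerical semigroup or a relative ideal. This set is
  infinite, so \<^const>\<open>Max\<close> is not applicable.
\<close>
definition frob :: "int set \<Rightarrow> int" where
  "frob I = (GREATEST z. z \<notin> I)"

definition max_ideal :: "int set \<Rightarrow> int set" where
  "max_ideal S = S - {0}"

definition multiplicity :: "int set \<Rightarrow> int" where
  "multiplicity S = (LEAST m. m \<in> max_ideal S)"

definition canonical :: "int set \<Rightarrow> int set" where
  "canonical S = {x. 0 \<le> x \<and> frob S - x \<notin> S}"

definition colon :: "int set \<Rightarrow> int set \<Rightarrow> int set" where
  "colon X Y = {z. z +o Y \<subseteq> X}"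

definition pseudo_frob :: "int set \<Rightarrow> int set" where
  "pseudo_frob S = colon S (max_ideal S) - S"

definition minimal_generating_system :: "int set \<Rightarrow> int set \<Rightarrow> bool" where
  "minimal_generating_system S A \<longleftrightarrow>
     add_submonoid hull A = S \<and> (\<forall>B. B \<subset> A \<longrightarrow> add_submonoid hull B \<noteq> S)"

definition minimal_generator :: "int set \<Rightarrow> int \<Rightarrow> bool" where
  "minimal_generator S x \<longleftrightarrow> (\<exists>A. minimal_generating_system S A \<and> x \<in> A)"

definition GAS :: "int set \<Rightarrow> bool" where
  "GAS S \<longleftrightarrow>
     (let K = canonical S in
       K + K = K \<or>
       (\<exists>(r::nat) (x :: nat \<Rightarrow> int).
          (\<forall>i\<in>{1..r}. minimal_generator S (x i)) \<and>
          (\<forall>i\<in>{1..r}. \<forall>j\<in>{1..r}. x i - x j \<notin> pseudo_frob S) \<and>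
          (K + K) - K = (\<lambda>i. frob S - x i) ` {1..r} \<union> {frob S}))"

definition relative_ideal :: "int set \<Rightarrow> int set \<Rightarrow> bool" where
  "relative_ideal T I \<longleftrightarrow> I \<noteq> {} \<and> I + T \<subseteq> I \<and> (\<exists>z\<in>T. z +o I \<subseteq> T)"

definition normalized :: "int set \<Rightarrow> int set \<Rightarrow> int set" where
  "normalized T I = (frob T - frob I) +o I"

definition almost_canonical :: "int set \<Rightarrow> int set \<Rightarrow> bool" where
  "almost_canonical T I \<longleftrightarrow>
     relative_ideal T I \<and>
     colon (normalized T I) (max_ideal T) = canonical T \<union> {frob T}"

lemma numerical_semigroup_colon_max_ideal:
  assumes S: "numerical_semigroup S"
  shows "numerical_semigroup (colon (max_ideal S) (max_ideal S))"
proof -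
  let ?M = "max_ideal S"
  have pos: "0 < m" if "m \<in> ?M" for m
    using S that by (fastforce simp: numerical_semigroup_def max_ideal_def)
  have add: "x + m \<in> ?M" if "x \<in> S" "m \<in> ?M" for x m
  proof -
    have "0 \<le> x" "x + m \<in> S"
      using S that by (auto simp: numerical_semigroup_def add_submonoid_def max_ideal_def)
    then show ?thesis using pos[OF that(2)] by (simp add: max_ideal_def)
  qed
  have mem: "x \<in> colon ?M ?M \<longleftrightarrow> (\<forall>m\<in>?M. x + m \<in> ?M)" for x
    by (auto simp: colon_def elt_set_plus_def)
  have sub: "S \<subseteq> colon ?M ?M" using add mem by blast
  have "?M \<noteq> {}"
  proof
    assume "?M = {}"
    then have "{1::int..} \<subseteq> {0..} - S" by (auto simp: max_ideal_def)
    then have "finite {1::int..}"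
      using S finite_subset unfolding numerical_semigroup_def by blast
    then show False using infinite_Ici by blast
  qed
  then obtain m0 where m0: "m0 \<in> ?M" by blast
  have nonneg: "0 \<le> x" if x: "x \<in> colon ?M ?M" for x
  proof (rule ccontr)
    assume neg: "\<not> 0 \<le> x"
    have "m0 + int k * x \<in> ?M" for k
    proof (induction k)
      case (Suc k)
      then have "x + (m0 + int k * x) \<in> ?M" using x mem by blast
      then show ?case by (simp add: algebra_simps)
    qed (use m0 in simp)
    then have "0 < m0 + int (nat m0) * x" using pos by blast
    moreover have "m0 * x \<le> m0 * (-1)"
      using neg pos[OF m0] by (intro mult_left_mono) auto
    ultimately show False using pos[OF m0] by simp
  qed
  have "0 \<in> colon ?M ?M" using mem by simp
  moreover have "x + y \<in> colon ?M ?M" if "x \<in> colon ?M ?M" "y \<in> colon ?M ?M" for x y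
    using that by (auto simp: mem add.assoc)
  moreover have "finite ({0..} - colon ?M ?M)"
    using S sub by (auto simp: numerical_semigroup_def elim: finite_subset[rotated])
  ultimately show ?thesis
    using nonneg by (auto simp: numerical_semigroup_def add_submonoid_def)
qed

end

theory Submission
  imports Defs
begin

text \<open>
  Write \<open>F\<close>, \<open>K\<close>, \<open>T\<close> for the Frobenius number, the standard canonical ideal and the semigroup
  \<open>M - M\<close>. The theorem holds because both properties say the same thing, namely that
  \<open>K + M\<close> is contained in the colon ideal \<open>M - (T \<setminus> {0})\<close>.

  The tool is duality: \<open>x \<in> K\<close> if and only if \<open>F - x \<notin> S\<close>, for every integer \<open>x\<close>. Since \<open>S\<close> is
  proper, \<open>T\<close> is also \<open>S - M\<close>, so that \<open>T = S \<union> PF(S)\<close>, and dualising gives \<open>z \<in> K + M\<close> if and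
  only if \<open>F - z \<notin> T\<close>.

  On the side of ideals, \<open>T\<close> and \<open>M - e\<close> have the same Frobenius number \<open>F - e\<close>, so \<open>M - e\<close> is
  already normalised, and the last equivalence reads \<open>K(T) = (K + M) - e\<close>. After translation
  by \<open>e\<close>, almost canonicity is therefore the equality \<open>M - (T \<setminus> {0}) = (K + M) \<union> {F}\<close>. Here the
  inclusion from left to right is automatic: if \<open>z \<notin> K + M\<close>, then \<open>F - z \<in> T\<close>, and
  \<open>F - z \<noteq> 0\<close> would give \<open>F = z + (F - z) \<in> M\<close>. As \<open>F\<close> lies in the left-hand side, only
  \<open>K + M \<subseteq> M - (T \<setminus> {0})\<close> remains.

  On the side of GAS, duality turns \<open>2K \<setminus> K\<close> into the set \<open>S \<setminus> (S - K)\<close>, whose nonzero elements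
  are the candidates for the \<open>x\<^sub>i\<close>. Minimal generators are the elements of \<open>M\<close> outside
  \<open>M + M\<close>, so the \<open>x\<^sub>i\<close> are minimal generators if and only if \<open>M + M + K \<subseteq> S\<close>. The condition
  that no difference of two of them is in \<open>PF(S)\<close> says that \<open>x + p + K \<subseteq> S\<close> for \<open>x \<in> M\<close> and
  \<open>p \<in> PF(S)\<close>. As \<open>T \<setminus> {0} = M \<union> PF(S)\<close>, both together say that
  \<open>K + M \<subseteq> M - (T \<setminus> {0})\<close>.
\<close>

section \<open>Frobenius number and multiplicity\<close>

lemma mem_colon: "z \<in> colon X Y \<longleftrightarrow> (\<forall>y\<in>Y. z + y \<in> X)"
  by (auto simp: colon_def elt_set_plus_def)

lemma mem_set_plus_iff_diff: "z \<in> A + B \<longleftrightarrow> (\<exists>b\<in>B. z - b \<in> A)" for z :: int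
proof
  assume "\<exists>b\<in>B. z - b \<in> A"
  then obtain b where "b \<in> B" "z - b \<in> A" by blast
  then show "z \<in> A + B" using set_plus_intro[of "z - b" A b B] by simp
qed (force elim!: set_plus_elim)

lemma frob_eqI:
  assumes "z \<notin> I" "\<And>y. z < y \<Longrightarrow> y \<in> I"
  shows "frob I = z"
  unfolding frob_def using assms by (intro Greatest_equality) (auto simp: not_less[symmetric])

locale proper_numerical_semigroup =
  fixes S :: "int set"
  assumes semigroup: "numerical_semigroup S" and proper: "S \<noteq> {0..}"
begin

abbreviation "M \<equiv> max_ideal S"
abbreviation "K \<equiv> canonical S"
abbreviation "F \<equiv> frob S"
abbreviation "e \<equiv> multiplicity S"
abbreviation "T \<equiv> colon M M"

lemma nonneg: "x \<in> S \<Longrightarrow> 0 \<le> x"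
  using semigroup by (auto simp: numerical_semigroup_def)

lemma zero_mem: "0 \<in> S"
  using semigroup by (auto simp: numerical_semigroup_def add_submonoid_def)

lemma add_mem: "x \<in> S \<Longrightarrow> y \<in> S \<Longrightarrow> x + y \<in> S"
  using semigroup by (auto simp: numerical_semigroup_def add_submonoid_def)

lemma mem_M: "x \<in> M \<longleftrightarrow> x \<in> S \<and> 0 < x"
  using nonneg by (force simp: max_ideal_def)

lemma frob_props: "F \<notin> S" "0 < F" "F < y \<Longrightarrow> y \<in> S"
proof -
  let ?G = "{0..} - S"
  have fin: "finite ?G" and "?G \<noteq> {}"
    using semigroup proper by (auto simp: numerical_semigroup_def)
  then have G: "Max ?G \<in> ?G" by (rule Max_in)
  have above: "y \<in> S" if "Max ?G < y" for y
  proof (rule ccontr)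
    assume "y \<notin> S"
    then have "y \<in> ?G" using that G by auto
    then show False using Max_ge[OF fin] that by fastforce
  qed
  have F: "F = Max ?G"
    using G above by (intro frob_eqI) auto
  show "F \<notin> S" using G F by auto
  show "0 < F" using G F zero_mem by (metis Diff_iff atLeast_iff order_le_less)
  show "F < y \<Longrightarrow> y \<in> S" using above F by auto
qed

lemma multiplicity_props: "e \<in> M" "m \<in> M \<Longrightarrow> e \<le> m"
proof -
  have "F + 1 \<in> M" using frob_props by (simp add: mem_M)
  then obtain m0 where m0: "m0 \<in> M" and least: "\<forall>m. m \<in> M \<longrightarrow> nat m0 \<le> nat m"
    using ex_has_least_nat[of "\<lambda>m. m \<in> M" _ nat] by blast
  have le: "m0 \<le> m" if "m \<in> M" for m
    using least that by (auto simp: mem_M)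
  have "e = m0"
    unfolding multiplicity_def using m0 le by (rule Least_equality)
  then show "e \<in> M" "m \<in> M \<Longrightarrow> e \<le> m" using m0 le by auto
qed

section \<open>Duality\<close>

text \<open>
  The sign condition in \<^const>\<open>canonical\<close> is implied, since everything above \<open>F\<close> is in \<open>S\<close>; this
  makes \<open>x \<mapsto> F - x\<close> a bijection between \<open>K\<close> and the complement of \<open>S\<close>.
\<close>
lemma mem_K: "x \<in> K \<longleftrightarrow> F - x \<notin> S"
  using frob_props(3)[of "F - x"] by (cases "x < 0") (auto simp: canonical_def)

lemma zero_mem_K: "0 \<in> K"
  using frob_props by (simp add: mem_K)

text \<open>
  A sum \<open>z + m\<close> in \<open>S\<close> cannot vanish: it would force \<open>z + (F + m) = F\<close>, although \<open>F + m \<in> M\<close>.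
  For \<open>S = \<nat>\<close> this fails, since \<open>-1 + M = S\<close>.
\<close>
lemma mem_T: "z \<in> T \<longleftrightarrow> (\<forall>m\<in>M. z + m \<in> S)"
proof
  assume z: "\<forall>m\<in>M. z + m \<in> S"
  have "z + m \<noteq> 0" if "m \<in> M" for m
  proof
    assume "z + m = 0"
    moreover have "F + m \<in> M" using that frob_props by (simp add: mem_M)
    ultimately have "F \<in> S" using z by (metis add.assoc add.commute add.right_neutral)
    then show False using frob_props by simp
  qed
  then show "z \<in> T" using z by (auto simp: mem_colon max_ideal_def)
qed (auto simp: mem_colon mem_M)

lemma T_semigroup: "numerical_semigroup T"
  using semigroup by (rule numerical_semigroup_colon_max_ideal)

lemma T_eq: "T = S \<union> pseudo_frob S"
proof -
  have "T = colon S M" by (simp add: set_eq_iff mem_T mem_colon[of _ S])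
  moreover have "S \<subseteq> colon S M" using add_mem by (auto simp: mem_colon mem_M)
  ultimately show ?thesis by (auto simp: pseudo_frob_def)
qed

lemma zero_notin_pseudo_frob: "0 \<notin> pseudo_frob S"
  using zero_mem by (simp add: pseudo_frob_def)

lemma max_ideal_T: "max_ideal T = M \<union> pseudo_frob S"
  using zero_notin_pseudo_frob unfolding T_eq by (auto simp: max_ideal_def)

lemma max_ideal_T_pos: "t \<in> max_ideal T \<Longrightarrow> 0 < t"
  using T_semigroup by (fastforce simp: numerical_semigroup_def max_ideal_def)

text \<open>The dual of \<open>T = S - M\<close> is \<open>K + M\<close>.\<close>
lemma mem_K_plus_M: "z \<in> K + M \<longleftrightarrow> F - z \<notin> T"
proof -
  have "z \<in> K + M \<longleftrightarrow> (\<exists>m\<in>M. z - m \<in> K)"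
    by (rule mem_set_plus_iff_diff)
  also have "\<dots> \<longleftrightarrow> (\<exists>m\<in>M. F - z + m \<notin> S)"
    by (simp add: mem_K algebra_simps)
  finally show ?thesis by (simp add: mem_T)
qed

text \<open>
  The dual of \<open>2K\<close> is \<open>S - K\<close>, so that the dual of \<open>2K \<setminus> K\<close> is \<open>S \<setminus> (S - K)\<close>.
\<close>
lemma double_K_diff_K: "(K + K) - K = (\<lambda>x. F - x) ` (S - colon S K)"
proof -
  have "F - x \<in> K + K \<longleftrightarrow> x \<notin> colon S K" for x
  proof -
    have "F - x \<in> K + K \<longleftrightarrow> (\<exists>k\<in>K. F - x - k \<in> K)"
      by (rule mem_set_plus_iff_diff)
    then show ?thesis by (simp add: mem_K mem_colon)
  qed
  then have dual: "F - x \<in> (K + K) - K \<longleftrightarrow> x \<in> S - colon S K" for x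
    by (auto simp: mem_K)
  show ?thesis
  proof (intro equalityI subsetI)
    fix z assume "z \<in> (K + K) - K"
    then have "F - z \<in> S - colon S K" using dual[of "F - z"] by simp
    then show "z \<in> (\<lambda>x. F - x) ` (S - colon S K)" by (intro image_eqI[of _ _ "F - z"]) auto
  qed (use dual in blast)
qed

section \<open>Minimal generators\<close>

lemma add_submonoid_hull: "add_submonoid (add_submonoid hull A)"
  by (rule hull_in) (auto simp: add_submonoid_def)

text \<open>
  In any minimal generating system, the elements of \<open>S\<close> smaller than a generator \<open>x\<close> are sums of
  the other generators, so \<open>x\<close> is superfluous if it is a sum of two such elements. Conversely,
  descent shows that the indecomposable elements of \<open>M\<close> generate \<open>S\<close>, and none of them can be
  dropped, because removing an indecomposable element from \<open>S\<close> leaves a submonoid.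
\<close>
lemma minimal_generator_iff: "minimal_generator S x \<longleftrightarrow> x \<in> M - (M + M)"
proof
  assume "minimal_generator S x"
  then obtain A where hull: "add_submonoid hull A = S" and xA: "x \<in> A"
    and min: "\<forall>B. B \<subset> A \<longrightarrow> add_submonoid hull B \<noteq> S"
    unfolding minimal_generator_def minimal_generating_system_def by blast
  define H where "H = add_submonoid hull (A - {x})"
  have H: "add_submonoid H" by (simp add: H_def add_submonoid_hull)
  have AS: "A \<subseteq> S" using hull_subset[of A add_submonoid] hull by simp
  have AH: "A - {x} \<subseteq> H" by (simp add: H_def hull_subset)
  have x_notin: "x \<notin> H"
  proof
    assume "x \<in> H"
    then have "A \<subseteq> H" using AH by blast
    then have "S \<subseteq> H" using H hull by (metis hull_minimal)
    moreover have "H \<subseteq> S"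
      using hull hull_mono[of "A - {x}" A add_submonoid] by (auto simp: H_def)
    ultimately show False using min xA unfolding H_def by blast
  qed
  have "add_submonoid {y. 0 \<le> y \<and> (y < x \<longrightarrow> y \<in> H)}"
    using H by (auto simp: add_submonoid_def)
  moreover have "A \<subseteq> {y. 0 \<le> y \<and> (y < x \<longrightarrow> y \<in> H)}"
    using AS AH nonneg by auto
  ultimately have "S \<subseteq> {y. 0 \<le> y \<and> (y < x \<longrightarrow> y \<in> H)}"
    using hull by (metis hull_minimal)
  then have below: "y \<in> H" if "y \<in> S" "y < x" for y using that by auto
  have "x \<noteq> 0" using x_notin H by (auto simp: add_submonoid_def)
  then have "x \<in> M" using AS xA by (auto simp: max_ideal_def)
  moreover have "x \<notin> M + M"
  proof
    assume "x \<in> M + M"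
    then obtain a b where "x = a + b" "a \<in> M" "b \<in> M" by (auto elim: set_plus_elim)
    moreover from this have "a \<in> H" "b \<in> H" using below by (auto simp: mem_M)
    ultimately show False using x_notin H by (auto simp: add_submonoid_def)
  qed
  ultimately show "x \<in> M - (M + M)" by simp
next
  let ?A = "M - (M + M)"
  assume x: "x \<in> ?A"
  have "y \<in> add_submonoid hull ?A" if "y \<in> S" for y
    using that
  proof (induction "nat y" arbitrary: y rule: less_induct)
    case less
    consider "y = 0" | "y \<in> ?A" | "y \<in> M + M" using less.prems by (auto simp: max_ideal_def)
    then show ?case
    proof cases
      case 1
      then show ?thesis using add_submonoid_hull by (auto simp: add_submonoid_def)
    next
      case 2
      then show ?thesis by (rule hull_inc)
    next
      case 3
      then obtain a b where ab: "y = a + b" "a \<in> M" "b \<in> M" by (auto elim: set_plus_elim)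
      then have "a \<in> add_submonoid hull ?A" "b \<in> add_submonoid hull ?A"
        using less.hyps by (auto simp: mem_M)
      then show ?thesis
        using ab add_submonoid_hull[of ?A] by (auto simp: add_submonoid_def)
    qed
  qed
  moreover have "add_submonoid hull ?A \<subseteq> S"
    using semigroup by (intro hull_minimal) (auto simp: numerical_semigroup_def mem_M)
  ultimately have "add_submonoid hull ?A = S" by blast
  moreover have "add_submonoid hull B \<noteq> S" if "B \<subset> ?A" for B
  proof -
    from that obtain y where y: "y \<in> ?A" "y \<notin> B" by blast
    have "add_submonoid (S - {y})"
      unfolding add_submonoid_def
    proof (intro conjI ballI)
      show "0 \<in> S - {y}" using zero_mem y by (auto simp: max_ideal_def)
      fix a b assume ab: "a \<in> S - {y}" "b \<in> S - {y}"
      have "a + b \<noteq> y"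
      proof
        assume sum: "a + b = y"
        then have "a \<in> M" "b \<in> M" using ab by (auto simp: max_ideal_def)
        then show False using sum y by auto
      qed
      then show "a + b \<in> S - {y}" using ab add_mem by auto
    qed
    moreover have "B \<subseteq> S - {y}" using that y by (auto simp: max_ideal_def)
    ultimately have "add_submonoid hull B \<subseteq> S - {y}" by (rule hull_minimal[rotated])
    then show ?thesis using y by (auto simp: max_ideal_def)
  qed
  ultimately show "minimal_generator S x"
    using x unfolding minimal_generator_def minimal_generating_system_def by blast
qed

section \<open>Both properties as an inclusion\<close>

text \<open>
  The list of the \<open>x\<^sub>i\<close> in \<^const>\<open>GAS\<close> is determined by \<open>S\<close>: it enumerates the nonzero elements of
  \<open>S \<setminus> (S - K)\<close>. The alternative \<open>2K = K\<close> is the case where this set does not even contain \<open>0\<close>,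
  that is, \<open>K \<subseteq> S\<close>.
\<close>
lemma GAS_iff_dual:
  "GAS S \<longleftrightarrow>
     (\<forall>x\<in>M - colon S K. x \<notin> M + M) \<and>
     (\<forall>x\<in>M - colon S K. \<forall>y\<in>M - colon S K. x - y \<notin> pseudo_frob S)"
    (is "_ \<longleftrightarrow> (\<forall>x\<in>?L. _ x) \<and> _")
proof
  assume "GAS S"
  then consider "K + K = K"
    | r x where "\<forall>i\<in>{1..r::nat}. minimal_generator S (x i)"
      "\<forall>i\<in>{1..r}. \<forall>j\<in>{1..r}. x i - x j \<notin> pseudo_frob S"
      "(K + K) - K = (\<lambda>i. F - x i) ` {1..r} \<union> {F}"
    by (auto simp: GAS_def Let_def)
  then show "(\<forall>x\<in>?L. x \<notin> M + M) \<and> (\<forall>x\<in>?L. \<forall>y\<in>?L. x - y \<notin> pseudo_frob S)"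
  proof cases
    case 1
    then have "S - colon S K = {}" using double_K_diff_K by auto
    then have "?L = {}" by (auto simp: max_ideal_def)
    then show ?thesis by blast
  next
    case 2
    have "\<exists>i\<in>{1..r}. y = x i" if "y \<in> ?L" for y
    proof -
      have "F - y \<in> (K + K) - K" unfolding double_K_diff_K using that by (auto simp: mem_M)
      then have "F - y \<in> (\<lambda>i. F - x i) ` {1..r} \<union> {F}" using 2(3) by simp
      then show ?thesis using that by (auto simp: max_ideal_def)
    qed
    then show ?thesis using 2(1,2) minimal_generator_iff by (metis Diff_iff)
  qed
next
  assume L: "(\<forall>x\<in>?L. x \<notin> M + M) \<and> (\<forall>x\<in>?L. \<forall>y\<in>?L. x - y \<notin> pseudo_frob S)"
  show "GAS S"
  proof (cases "0 \<in> colon S K")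
    case True
    then have "K \<subseteq> S" by (auto simp: mem_colon)
    then have "S - colon S K = {}" using add_mem by (fastforce simp: mem_colon)
    then have "K + K \<subseteq> K" using double_K_diff_K by auto
    moreover have "K \<subseteq> K + K" using set_plus_intro[OF zero_mem_K] by fastforce
    ultimately show ?thesis by (auto simp: GAS_def Let_def)
  next
    case False
    have "?L \<subseteq> {0..F}"
    proof
      fix x assume x: "x \<in> ?L"
      then obtain k where "k \<in> K" "x + k \<notin> S" by (auto simp: mem_colon)
      then show "x \<in> {0..F}"
        using x frob_props(3)[of "x + k"] by (force simp: mem_M canonical_def)
    qed
    then have "finite ?L" by (rule finite_subset) simp
    then obtain x where "bij_betw x {1..card ?L} ?L"
      using ex_bij_betw_nat_finite_1 by blast
    then have x: "x ` {1..card ?L} = ?L" by (rule bij_betw_imp_surj_on)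
    have "S - colon S K = ?L \<union> {0}" using False zero_mem by (auto simp: max_ideal_def)
    then have "(K + K) - K = (\<lambda>x. F - x) ` ?L \<union> {F}"
      unfolding double_K_diff_K by auto
    also have "\<dots> = (\<lambda>i. F - x i) ` {1..card ?L} \<union> {F}"
      by (subst x[symmetric]) (simp only: image_image)
    finally have eq: "(K + K) - K = (\<lambda>i. F - x i) ` {1..card ?L} \<union> {F}" .
    have xL: "x i \<in> ?L" if "i \<in> {1..card ?L}" for i using x that by blast
    have "minimal_generator S (x i)" if "i \<in> {1..card ?L}" for i
      using L xL[OF that] minimal_generator_iff by blast
    moreover have "x i - x j \<notin> pseudo_frob S"
      if "i \<in> {1..card ?L}" "j \<in> {1..card ?L}" for i j
      using L xL that by blast
    ultimately show ?thesis using eq unfolding GAS_def Let_def by blast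
  qed
qed

text \<open>
  The first condition of the dual form says that \<open>M + M + K \<subseteq> S\<close>. For the second, let
  \<open>p \<in> PF(S)\<close> and \<open>y \<in> M\<close>, so that \<open>y + p \<in> M\<close>. If \<open>y + K \<subseteq> S\<close>, then these sums lie in \<open>M\<close> and
  adding \<open>p\<close> stays in \<open>S\<close>; so the condition, which forbids that both \<open>y\<close> and \<open>y + p\<close> are outside
  \<open>S - K\<close>, says that \<open>y + p + K \<subseteq> S\<close> without exception.
\<close>
lemma GAS_iff: "GAS S \<longleftrightarrow> K + M \<subseteq> colon M (max_ideal T)"
proof -
  have K_nonneg: "0 \<le> k" if "k \<in> K" for k using that by (simp add: canonical_def)
  have T_add: "p + m \<in> M" if "p \<in> pseudo_frob S" "m \<in> M" for p m
    using that T_eq mem_colon[of p M M] by blast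
  have first: "(\<forall>x\<in>M - colon S K. x \<notin> M + M) \<longleftrightarrow> (\<forall>k\<in>K. \<forall>m\<in>M. \<forall>n\<in>M. k + m + n \<in> S)"
  proof
    assume L: "\<forall>x\<in>M - colon S K. x \<notin> M + M"
    show "\<forall>k\<in>K. \<forall>m\<in>M. \<forall>n\<in>M. k + m + n \<in> S"
    proof (intro ballI)
      fix k m n assume k: "k \<in> K" and mn: "m \<in> M" "n \<in> M"
      have "m + n \<in> M" using mn add_mem by (auto simp: mem_M)
      moreover have "m + n \<in> M + M" using mn by (rule set_plus_intro)
      ultimately have "m + n \<in> colon S K" using L by blast
      then show "k + m + n \<in> S" using k by (auto simp: mem_colon algebra_simps)
    qed
  next
    assume sums: "\<forall>k\<in>K. \<forall>m\<in>M. \<forall>n\<in>M. k + m + n \<in> S"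
    show "\<forall>x\<in>M - colon S K. x \<notin> M + M"
    proof (intro ballI notI)
      fix x assume x: "x \<in> M - colon S K" "x \<in> M + M"
      then obtain m n where "x = m + n" "m \<in> M" "n \<in> M" by (auto elim: set_plus_elim)
      then have "x \<in> colon S K" using sums by (auto simp: mem_colon algebra_simps)
      then show False using x by simp
    qed
  qed
  have second: "(\<forall>x\<in>M - colon S K. \<forall>y\<in>M - colon S K. x - y \<notin> pseudo_frob S) \<longleftrightarrow>
      (\<forall>k\<in>K. \<forall>m\<in>M. \<forall>p\<in>pseudo_frob S. k + m + p \<in> S)"
  proof
    assume L: "\<forall>x\<in>M - colon S K. \<forall>y\<in>M - colon S K. x - y \<notin> pseudo_frob S"
    show "\<forall>k\<in>K. \<forall>m\<in>M. \<forall>p\<in>pseudo_frob S. k + m + p \<in> S"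
    proof (intro ballI)
      fix k m p assume k: "k \<in> K" and m: "m \<in> M" and p: "p \<in> pseudo_frob S"
      have "m + p \<in> colon S K \<or> m \<in> colon S K"
        using L m p T_add[OF p m] by (metis DiffI add.commute add_diff_cancel_left')
      then show "k + m + p \<in> S"
      proof
        assume "m + p \<in> colon S K"
        then show ?thesis using k by (auto simp: mem_colon algebra_simps)
      next
        assume "m \<in> colon S K"
        then have "m + k \<in> M" using k m K_nonneg[OF k] by (auto simp: mem_colon mem_M)
        from T_add[OF p this] show ?thesis by (simp add: mem_M algebra_simps)
      qed
    qed
  next
    assume sums: "\<forall>k\<in>K. \<forall>m\<in>M. \<forall>p\<in>pseudo_frob S. k + m + p \<in> S"
    show "\<forall>x\<in>M - colon S K. \<forall>y\<in>M - colon S K. x - y \<notin> pseudo_frob S"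
    proof (intro ballI notI)
      fix x y assume x: "x \<in> M - colon S K" and y: "y \<in> M - colon S K"
        and p: "x - y \<in> pseudo_frob S"
      have "k + y + (x - y) \<in> S" if "k \<in> K" for k using sums that y p by blast
      then have "x \<in> colon S K" by (auto simp: mem_colon algebra_simps)
      then show False using x by simp
    qed
  qed
  have "k + m + t \<in> M \<longleftrightarrow> k + m + t \<in> S" if "k \<in> K" "m \<in> M" "t \<in> max_ideal T" for k m t
    using K_nonneg[OF that(1)] max_ideal_T_pos[OF that(3)] that(2) by (simp add: mem_M)
  then have "K + M \<subseteq> colon M (max_ideal T) \<longleftrightarrow>
      (\<forall>k\<in>K. \<forall>m\<in>M. \<forall>t\<in>max_ideal T. k + m + t \<in> S)"
    by (fastforce simp: set_plus_def mem_colon)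
  also have "\<dots> \<longleftrightarrow> (\<forall>k\<in>K. \<forall>m\<in>M. \<forall>n\<in>M. k + m + n \<in> S) \<and>
      (\<forall>k\<in>K. \<forall>m\<in>M. \<forall>p\<in>pseudo_frob S. k + m + p \<in> S)"
    unfolding max_ideal_T by blast
  finally show ?thesis unfolding GAS_iff_dual first second by simp
qed

lemma frob_T: "frob T = F - e"
proof (rule frob_eqI)
  show "F - e \<notin> T" using multiplicity_props(1) frob_props(1) by (force simp: mem_T)
  show "y \<in> T" if "F - e < y" for y
    using that multiplicity_props(2) frob_props(3) by (fastforce simp: mem_T)
qed

lemma frob_shifted_M: "frob ((\<lambda>m. m - e) ` M) = F - e"
proof (rule frob_eqI)
  show "F - e \<notin> (\<lambda>m. m - e) ` M" using frob_props by (auto simp: mem_M)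
  show "y \<in> (\<lambda>m. m - e) ` M" if "F - e < y" for y
    using that frob_props by (intro image_eqI[of _ _ "y + e"]) (auto simp: mem_M)
qed

lemma shifted_M_relative_ideal: "relative_ideal T ((\<lambda>m. m - e) ` M)"
proof -
  have "(m - e) + t \<in> (\<lambda>m. m - e) ` M" if "m \<in> M" "t \<in> T" for m t
    using that by (intro image_eqI[of _ _ "t + m"]) (auto simp: mem_colon)
  then have "(\<lambda>m. m - e) ` M + T \<subseteq> (\<lambda>m. m - e) ` M"
    by (auto elim!: set_plus_elim)
  moreover have "e \<in> T" "e +o (\<lambda>m. m - e) ` M \<subseteq> T"
    using multiplicity_props(1) T_eq by (auto simp: elt_set_plus_def mem_M)
  ultimately show ?thesis
    using multiplicity_props(1) by (auto simp: relative_ideal_def)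
qed

text \<open>
  An element \<open>z\<close> outside \<open>K + M\<close> has \<open>F - z \<in> T\<close>; so it carries a nonzero element of \<open>T\<close> to
  \<open>F \<notin> M\<close>, unless \<open>z = F\<close>.
\<close>
lemma colon_max_ideal_T_subset: "colon M (max_ideal T) \<subseteq> (K + M) \<union> {F}"
proof
  fix z assume z: "z \<in> colon M (max_ideal T)"
  show "z \<in> (K + M) \<union> {F}"
  proof (rule ccontr)
    assume "z \<notin> (K + M) \<union> {F}"
    then have "F - z \<in> T" "F - z \<noteq> 0" using mem_K_plus_M[of z] by auto
    then have "F - z \<in> max_ideal T" unfolding max_ideal_def[of T] by blast
    then have "z + (F - z) \<in> M" using z by (simp only: mem_colon)
    then show False using frob_props(1) by (simp add: mem_M)
  qed
qed

lemma almost_canonical_iff: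
  "almost_canonical T ((\<lambda>m. m - e) ` M) \<longleftrightarrow> K + M \<subseteq> colon M (max_ideal T)"
proof -
  have normalized: "normalized T ((\<lambda>m. m - e) ` M) = (\<lambda>m. m - e) ` M"
    by (simp add: normalized_def frob_T frob_shifted_M)
  have shift: "x \<in> (\<lambda>m. m - e) ` M \<longleftrightarrow> x + e \<in> M" for x
    by (auto intro: image_eqI[of _ _ "x + e"])
  have colon: "x \<in> colon ((\<lambda>m. m - e) ` M) (max_ideal T) \<longleftrightarrow> x + e \<in> colon M (max_ideal T)" for x
    by (simp add: mem_colon shift algebra_simps)
  have canonical: "x \<in> canonical T \<union> {frob T} \<longleftrightarrow> x + e \<in> (K + M) \<union> {F}" for x
  proof -
    have "y \<in> T" if "F - e < y" for y
      using that multiplicity_props(2) frob_props(3) by (fastforce simp: mem_T)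
    then have "x \<in> canonical T \<longleftrightarrow> F - (x + e) \<notin> T"
      by (force simp: canonical_def frob_T algebra_simps)
    then show ?thesis by (auto simp: frob_T mem_K_plus_M)
  qed
  have "F \<in> colon M (max_ideal T)"
    using max_ideal_T_pos frob_props by (fastforce simp: mem_colon mem_M)
  then have "K + M \<subseteq> colon M (max_ideal T) \<longleftrightarrow> colon M (max_ideal T) = (K + M) \<union> {F}"
    using colon_max_ideal_T_subset by blast
  also have "\<dots> \<longleftrightarrow> (\<forall>x. x + e \<in> colon M (max_ideal T) \<longleftrightarrow> x + e \<in> (K + M) \<union> {F})"
    unfolding set_eq_iff by (metis diff_add_cancel)
  also have "\<dots> \<longleftrightarrow> colon ((\<lambda>m. m - e) ` M) (max_ideal T) = canonical T \<union> {frob T}"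
    unfolding set_eq_iff colon canonical ..
  finally show ?thesis
    unfolding almost_canonical_def normalized using shifted_M_relative_ideal by blast
qed

end

theorem theorem3p13:
  fixes S M :: "int set" and e :: int
  assumes "numerical_semigroup S"
    and "S \<noteq> {0..}"
    and "M = max_ideal S"
    and "e = multiplicity S"
  shows "GAS S \<longleftrightarrow> almost_canonical (colon M M) ((\<lambda>m. m - e) ` M)"
proof -
  interpret proper_numerical_semigroup S
    using assms by unfold_locales
  show ?thesis
    unfolding assms(3,4) GAS_iff almost_canonical_iff ..
qed

end
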